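(* Let $T$ be a Berge trigraph and $(A_1,B_1,C_1,A_2,B_2,C_2)$ a split of a proper $2$-join of $T$. Then all paths with one end in $A_i$, one end in $B_i$ and interior in $C_i$, for $i=1,2$ (i.e., over both values of $i$ together), have lengths of the same parity.
   Context: A trigraph $T$ consists of a finite vertex set $V(T)$ and a map $\theta:\binom{V(T)}{2}\to\{-1,0,1\}$. Distinct $u,v$ are strongly adjacent if $\theta(uv)=1$, strongly antiadjacent if $\theta(uv)=-1$, a switchable pair if $\theta(uv)=0$; adjacent if $\theta(uv)\in\{0,1\}$, antiadjacent if $\theta(uv)\in\{-1,0\}$. The complement $\overline T$ has adjacency $-\theta$; $T|X$ is the induced trigraph. The full realization of $T$ is the graph on $V(T)$ whose edges are adjacent pairs; $X$ is connected if the full realization of $T|X$ is connected; components are maximal connected sets. A path is a sequence $p_1,\dots,p_k$ of distinct vertices with consecutive ones adjacent and non-consecutive ones antiadjacent; its length is $k-1$, its interior $\{p_2,\dots,p_{k-1}\}$. A hole is $h_1,\dots,h_k$, $k\ge4$, distinct, with $h_i,h_j$ adjacent iff $|i-j|\in\{1,k-1\}$ and antiadjacent otherwise; an antihole is an induced subtrigraph whose complement is a hole of $\overline T$. $T$ is Berge if it has no hole and no antihole of odd length. A $2$-join of $T$ is a partition $(X_1,X_2)$ of $V(T)$ for which there are disjoint sets $A_1,B_1,C_1,A_2,B_2,C_2$ (a split) with $X_i=A_i\cup B_i\cup C_i$, $A_1,A_2,B_1,B_2$ nonempty, no switchable pair meeting both $X_1$ and $X_2$, every vertex of $A_1$ strongly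 adjacent to every vertex of $A_2$, every vertex of $B_1$ strongly adjacent to every vertex of $B_2$, no other strongly adjacent pairs between $X_1$ and $X_2$, $|X_i|\ge3$, and for $i=1,2$, if $|A_i|=|B_i|=1$ then the full realization of $T|X_i$ is not a path of length two joining the vertex of $A_i$ to that of $B_i$. It is proper if for $i=1,2$ every component of $T|X_i$ meets both $A_i$ and $B_i$.
   Formalization: In the definition of a hole, "adjacent iff |i-j| is 1 or k-1" is read as "adjacent if |i-j| is 1 or k-1, antiadjacent otherwise", so non-consecutive vertices may form switchable pairs, as in paths; with the literal "iff" the claim fails. *)

theory Defs
  imports "Graph_Theory.Digraph_Component"
begin

text \<open>The map \<open>theta\<close> is only meaningful on the two-element subsets of \<open>vertices\<close>.\<close>

record 'a trigraph =
  vertices :: "'a set"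
  theta :: "'a set \<Rightarrow> int"

definition is_trigraph :: "'a trigraph \<Rightarrow> bool" where
  "is_trigraph T \<longleftrightarrow> finite (vertices T) \<and>
     (\<forall>u\<in>vertices T. \<forall>v\<in>vertices T. u \<noteq> v \<longrightarrow> theta T {u, v} \<in> {-1, 0, 1})"

definition distinct_verts :: "'a trigraph \<Rightarrow> 'a \<Rightarrow> 'a \<Rightarrow> bool" where
  "distinct_verts T u v \<longleftrightarrow> u \<in> vertices T \<and> v \<in> vertices T \<and> u \<noteq> v"

definition strongly_adjacent :: "'a trigraph \<Rightarrow> 'a \<Rightarrow> 'a \<Rightarrow> bool" where
  "strongly_adjacent T u v \<longleftrightarrow> distinct_verts T u v \<and> theta T {u, v} = 1"

definition switchable :: "'a trigraph \<Rightarrow> 'a \<Rightarrow> 'a \<Rightarrow> bool" where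
  "switchable T u v \<longleftrightarrow> distinct_verts T u v \<and> theta T {u, v} = 0"

definition adjacent :: "'a trigraph \<Rightarrow> 'a \<Rightarrow> 'a \<Rightarrow> bool" where
  "adjacent T u v \<longleftrightarrow> distinct_verts T u v \<and> theta T {u, v} \<in> {0, 1}"

definition antiadjacent :: "'a trigraph \<Rightarrow> 'a \<Rightarrow> 'a \<Rightarrow> bool" where
  "antiadjacent T u v \<longleftrightarrow> distinct_verts T u v \<and> theta T {u, v} \<in> {-1, 0}"

definition complement :: "'a trigraph \<Rightarrow> 'a trigraph" where
  "complement T = \<lparr>vertices = vertices T, theta = (\<lambda>e. - theta T e)\<rparr>"

definition induced :: "'a trigraph \<Rightarrow> 'a set \<Rightarrow> 'a trigraph" where
  "induced T X = \<lparr>vertices = vertices T \<inter> X, theta = theta T\<rparr>"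

text \<open>Undirected simple graphs are symmetric loop-free digraphs, as in the locale \<open>pair_graph\<close>.\<close>

definition full_realization :: "'a trigraph \<Rightarrow> 'a pair_pre_digraph" where
  "full_realization T = \<lparr>pverts = vertices T, parcs = {(u, v). adjacent T u v}\<rparr>"

lemma pair_graph_full_realization:
  assumes "is_trigraph T"
  shows "pair_graph (full_realization T)"
proof -
  let ?G = "full_realization T"
  have sub: "parcs ?G \<subseteq> vertices T \<times> vertices T"
    by (auto simp: full_realization_def adjacent_def distinct_verts_def)
  have fin: "finite (vertices T)"
    using assms by (simp add: is_trigraph_def)
  have "finite (parcs ?G)"
    using sub fin by (meson finite_SigmaI finite_subset)
  moreover have "sym (parcs ?G)"
    unfolding sym_def full_realization_def adjacent_def distinct_verts_def
    by (auto simp: insert_commute[of _ _ "{}"])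
  moreover have "fst e \<noteq> snd e" if "e \<in> parcs ?G" for e
    using that by (auto simp: full_realization_def adjacent_def distinct_verts_def)
  moreover have "pverts ?G = vertices T"
    by (simp add: full_realization_def)
  ultimately show ?thesis
    using sub fin by unfold_locales (auto simp: symmetric_def)
qed

definition connected_set :: "'a trigraph \<Rightarrow> 'a set \<Rightarrow> bool" where
  "connected_set T X \<longleftrightarrow> X \<subseteq> vertices T \<and>
     Digraph_Component.connected (with_proj (full_realization (induced T X)))"

definition components :: "'a trigraph \<Rightarrow> 'a set set" where
  "components T = {Y. connected_set T Y \<and> (\<forall>Z. connected_set T Z \<and> Y \<subseteq> Z \<longrightarrow> Z = Y)}"

definition is_path :: "'a trigraph \<Rightarrow> 'a list \<Rightarrow> bool" where
  "is_path T p \<longleftrightarrow> p \<noteq> [] \<and> set p \<subseteq> vertices T \<and> distinct p \<and>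
     (\<forall>i j. i < j \<and> j < length p \<longrightarrow>
        (if j - i = 1 then adjacent T (p ! i) (p ! j) else antiadjacent T (p ! i) (p ! j)))"

definition path_length :: "'a list \<Rightarrow> nat" where
  "path_length p = length p - 1"

definition interior :: "'a list \<Rightarrow> 'a set" where
  "interior p = set (butlast (tl p))"

text \<open>Non-consecutive vertices of a hole are antiadjacent, so they may form switchable pairs,
  exactly as for paths.\<close>

definition is_hole :: "'a trigraph \<Rightarrow> 'a list \<Rightarrow> bool" where
  "is_hole T h \<longleftrightarrow> 4 \<le> length h \<and> set h \<subseteq> vertices T \<and> distinct h \<and>
     (\<forall>i j. i < j \<and> j < length h \<longrightarrow>
        (if j - i \<in> {1, length h - 1}
         then adjacent T (h ! i) (h ! j) else antiadjacent T (h ! i) (h ! j)))"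

definition is_antihole :: "'a trigraph \<Rightarrow> 'a list \<Rightarrow> bool" where
  "is_antihole T h \<longleftrightarrow> is_hole (complement T) h"

definition Berge :: "'a trigraph \<Rightarrow> bool" where
  "Berge T \<longleftrightarrow> (\<forall>h. is_hole T h \<or> is_antihole T h \<longrightarrow> even (length h))"

definition is_path_graph :: "'a pair_pre_digraph \<Rightarrow> nat \<Rightarrow> 'a \<Rightarrow> 'a \<Rightarrow> bool" where
  "is_path_graph G n a b \<longleftrightarrow>
     (\<exists>p. length p = n + 1 \<and> distinct p \<and> hd p = a \<and> last p = b \<and> pverts G = set p \<and>
        parcs G = {(p ! i, p ! j) | i j.
          i < length p \<and> j < length p \<and> (j = i + 1 \<or> i = j + 1)})"

definition not_short_side :: "'a trigraph \<Rightarrow> 'a set \<Rightarrow> 'a set \<Rightarrow> 'a set \<Rightarrow> bool" where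
  "not_short_side T X A B \<longleftrightarrow>
     (\<forall>a b. A = {a} \<and> B = {b} \<longrightarrow> \<not> is_path_graph (full_realization (induced T X)) 2 a b)"

definition two_join_split ::
  "'a trigraph \<Rightarrow> 'a set \<Rightarrow> 'a set \<Rightarrow>
   'a set \<Rightarrow> 'a set \<Rightarrow> 'a set \<Rightarrow> 'a set \<Rightarrow> 'a set \<Rightarrow> 'a set \<Rightarrow> bool" where
  "two_join_split T X1 X2 A1 B1 C1 A2 B2 C2 \<longleftrightarrow>
     X1 \<union> X2 = vertices T \<and> X1 \<inter> X2 = {} \<and>
     X1 = A1 \<union> B1 \<union> C1 \<and> X2 = A2 \<union> B2 \<union> C2 \<and>
     A1 \<inter> B1 = {} \<and> A1 \<inter> C1 = {} \<and> B1 \<inter> C1 = {} \<and>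
     A2 \<inter> B2 = {} \<and> A2 \<inter> C2 = {} \<and> B2 \<inter> C2 = {} \<and>
     A1 \<noteq> {} \<and> A2 \<noteq> {} \<and> B1 \<noteq> {} \<and> B2 \<noteq> {} \<and>
     (\<forall>u\<in>X1. \<forall>v\<in>X2. \<not> switchable T u v) \<and>
     (\<forall>u\<in>A1. \<forall>v\<in>A2. strongly_adjacent T u v) \<and>
     (\<forall>u\<in>B1. \<forall>v\<in>B2. strongly_adjacent T u v) \<and>
     (\<forall>u\<in>X1. \<forall>v\<in>X2. strongly_adjacent T u v \<longrightarrow>
        (u \<in> A1 \<and> v \<in> A2) \<or> (u \<in> B1 \<and> v \<in> B2)) \<and>
     3 \<le> card X1 \<and> 3 \<le> card X2 \<and>
     not_short_side T X1 A1 B1 \<and> not_short_side T X2 A2 B2"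

definition proper_two_join_split ::
  "'a trigraph \<Rightarrow> 'a set \<Rightarrow> 'a set \<Rightarrow>
   'a set \<Rightarrow> 'a set \<Rightarrow> 'a set \<Rightarrow> 'a set \<Rightarrow> 'a set \<Rightarrow> 'a set \<Rightarrow> bool" where
  "proper_two_join_split T X1 X2 A1 B1 C1 A2 B2 C2 \<longleftrightarrow>
     two_join_split T X1 X2 A1 B1 C1 A2 B2 C2 \<and>
     (\<forall>Y\<in>components (induced T X1). Y \<inter> A1 \<noteq> {} \<and> Y \<inter> B1 \<noteq> {}) \<and>
     (\<forall>Y\<in>components (induced T X2). Y \<inter> A2 \<noteq> {} \<and> Y \<inter> B2 \<noteq> {})"

definition paths_through :: "'a trigraph \<Rightarrow> 'a set \<Rightarrow> 'a set \<Rightarrow> 'a set \<Rightarrow> 'a list set" where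
  "paths_through T A B C = {p. is_path T p \<and>
     (hd p \<in> A \<and> last p \<in> B \<or> hd p \<in> B \<and> last p \<in> A) \<and> interior p \<subseteq> C}"

end

theory Submission
  imports Defs "Graph_Theory.Vertex_Walk"
begin

text \<open>
  A path from \<open>A\<^sub>1\<close> to \<open>B\<^sub>1\<close> through \<open>C\<^sub>1\<close> followed by a path from \<open>B\<^sub>2\<close> to \<open>A\<^sub>2\<close> through \<open>C\<^sub>2\<close>
  closes up to a hole, which has even length; hence paths on opposite sides have the same parity.
  Two paths on the same side are compared through a path on the other side, which exists because
  properness puts a vertex of \<open>A\<close> and a vertex of \<open>B\<close> in one component of that side, and a
  shortest walk from \<open>A\<close> to \<open>B\<close> there is a path with interior in \<open>C\<close>.
\<close>

subsection \<open>Adjacency patterns\<close>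

lemma adjacent_commute: "adjacent T u v \<longleftrightarrow> adjacent T v u"
  by (auto simp: adjacent_def distinct_verts_def insert_commute)

lemma antiadjacent_commute: "antiadjacent T u v \<longleftrightarrow> antiadjacent T v u"
  by (auto simp: antiadjacent_def distinct_verts_def insert_commute)

lemma not_adjacent_imp_antiadjacent:
  assumes "is_trigraph T" "u \<in> vertices T" "v \<in> vertices T" "u \<noteq> v" "\<not> adjacent T u v"
  shows "antiadjacent T u v"
  using assms by (auto simp: is_trigraph_def adjacent_def antiadjacent_def distinct_verts_def)

definition prescribed_adjacency :: "'a trigraph \<Rightarrow> bool \<Rightarrow> 'a \<Rightarrow> 'a \<Rightarrow> bool" where
  "prescribed_adjacency T b u v \<longleftrightarrow> (if b then adjacent T u v else antiadjacent T u v)"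

lemma prescribed_adjacency_commute:
  "prescribed_adjacency T b u v \<longleftrightarrow> prescribed_adjacency T b v u"
  unfolding prescribed_adjacency_def
  using adjacent_commute[of T u v] antiadjacent_commute[of T u v] by simp

definition adjacency_pattern :: "'a trigraph \<Rightarrow> (nat \<Rightarrow> nat \<Rightarrow> bool) \<Rightarrow> 'a list \<Rightarrow> bool" where
  "adjacency_pattern T P p \<longleftrightarrow>
     (\<forall>i j. i < j \<and> j < length p \<longrightarrow> prescribed_adjacency T (P i j) (p ! i) (p ! j))"

lemma adjacency_patternD:
  "\<lbrakk>adjacency_pattern T P p; i < j; j < length p\<rbrakk> \<Longrightarrow>
     prescribed_adjacency T (P i j) (p ! i) (p ! j)"
  by (simp add: adjacency_pattern_def)

lemma is_path_iff_adjacency_pattern: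
  "is_path T p \<longleftrightarrow> p \<noteq> [] \<and> set p \<subseteq> vertices T \<and> distinct p \<and>
     adjacency_pattern T (\<lambda>i j. j - i = 1) p"
  by (simp add: is_path_def adjacency_pattern_def prescribed_adjacency_def)

lemma is_hole_iff_adjacency_pattern:
  "is_hole T h \<longleftrightarrow> 4 \<le> length h \<and> set h \<subseteq> vertices T \<and> distinct h \<and>
     adjacency_pattern T (\<lambda>i j. j - i \<in> {1, length h - 1}) h"
  by (simp add: is_hole_def adjacency_pattern_def prescribed_adjacency_def)

lemma adjacency_pattern_rev:
  assumes pattern: "adjacency_pattern T P p"
    and reflect: "\<And>i j. \<lbrakk>i < j; j < length p\<rbrakk> \<Longrightarrow> Q i j = P (length p - Suc j) (length p - Suc i)"
  shows "adjacency_pattern T Q (rev p)"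
  unfolding adjacency_pattern_def
proof (intro allI impI)
  fix i j
  assume "i < j \<and> j < length (rev p)"
  then have ij: "i < j" "j < length p" by simp_all
  then have "prescribed_adjacency T (Q i j) (p ! (length p - Suc j)) (p ! (length p - Suc i))"
    using adjacency_patternD[OF pattern, of "length p - Suc j" "length p - Suc i"]
    by (simp add: reflect)
  then show "prescribed_adjacency T (Q i j) (rev p ! i) (rev p ! j)"
    using ij by (simp add: rev_nth prescribed_adjacency_commute)
qed

lemma adjacency_pattern_append:
  assumes left: "adjacency_pattern T P p" and right: "adjacency_pattern T Q q"
    and cross: "\<And>i j. \<lbrakk>i < length p; j < length q\<rbrakk> \<Longrightarrow>
      prescribed_adjacency T (R i (length p + j)) (p ! i) (q ! j)"
    and R_left: "\<And>i j. \<lbrakk>i < j; j < length p\<rbrakk> \<Longrightarrow> R i j = P i j"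
    and R_right: "\<And>i j. \<lbrakk>i < j; j < length q\<rbrakk> \<Longrightarrow> R (length p + i) (length p + j) = Q i j"
  shows "adjacency_pattern T R (p @ q)"
  unfolding adjacency_pattern_def
proof (intro allI impI)
  fix i j
  assume ij: "i < j \<and> j < length (p @ q)"
  consider (both_left) "j < length p" | (across) "i < length p" "length p \<le> j"
    | (both_right) "length p \<le> i"
    by linarith
  then show "prescribed_adjacency T (R i j) ((p @ q) ! i) ((p @ q) ! j)"
  proof cases
    case both_left
    then show ?thesis
      using adjacency_patternD[OF left, of i j] ij by (simp add: nth_append R_left)
  next
    case across
    then show ?thesis
      using cross[of i "j - length p"] ij by (simp add: nth_append)
  next
    case both_right
    then have shifted: "i - length p < j - length p" "j - length p < length q"
      using ij by auto
    show ?thesis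
      using adjacency_patternD[OF right shifted] R_right[OF shifted] both_right ij
      by (simp add: nth_append)
  qed
qed

lemma is_path_rev:
  assumes "is_path T p"
  shows "is_path T (rev p)"
  using assms unfolding is_path_iff_adjacency_pattern
  by (auto elim!: adjacency_pattern_rev)

lemma is_hole_append_paths:
  assumes p: "is_path T p" "2 \<le> length p" and q: "is_path T q" "2 \<le> length q"
    and disjoint: "set p \<inter> set q = {}"
    and cross: "\<And>i j. \<lbrakk>i < length p; j < length q\<rbrakk> \<Longrightarrow>
      prescribed_adjacency T (i = 0 \<and> j = length q - 1 \<or> i = length p - 1 \<and> j = 0) (p ! i) (q ! j)"
  shows "is_hole T (p @ q)"
proof -
  have "adjacency_pattern T (\<lambda>i j. j - i \<in> {1, length (p @ q) - 1}) (p @ q)"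
  proof (rule adjacency_pattern_append)
    show "adjacency_pattern T (\<lambda>i j. j - i = 1) p" "adjacency_pattern T (\<lambda>i j. j - i = 1) q"
      using p q by (simp_all add: is_path_iff_adjacency_pattern)
  next
    fix i j
    assume ij: "i < length p" "j < length q"
    then have "length p + j - i \<in> {1, length (p @ q) - 1} \<longleftrightarrow>
        i = 0 \<and> j = length q - 1 \<or> i = length p - 1 \<and> j = 0"
      using p(2) q(2) by auto
    then show "prescribed_adjacency T (length p + j - i \<in> {1, length (p @ q) - 1}) (p ! i) (q ! j)"
      using cross[OF ij] by simp
  qed (use p(2) q(2) in auto)
  then show ?thesis
    using p q disjoint by (auto simp: is_path_iff_adjacency_pattern is_hole_iff_adjacency_pattern)
qed

subsection \<open>Paths between two sets\<close>

lemma interior_conv_nth: "interior p = {p ! i | i. 0 < i \<and> Suc i < length p}"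
proof -
  have shift: "butlast (tl p) ! k = p ! Suc k" if "k < length p - 2" for k
    using that by (simp add: nth_butlast nth_tl)
  have "interior p = {butlast (tl p) ! k | k. k < length p - 2}"
    by (simp add: interior_def set_conv_nth numeral_2_eq_2)
  also have "\<dots> = {p ! Suc k | k. k < length p - 2}"
    by (rule Collect_cong) (metis shift)
  also have "\<dots> = {p ! i | i. 0 < i \<and> Suc i < length p}"
    by (auto simp: gr0_conv_Suc less_diff_conv)
  finally show ?thesis .
qed

lemma interior_rev: "interior (rev p) = interior p"
  by (metis butlast_rev butlast_tl interior_def rev_rev_ident set_rev)

definition directed_paths_through ::
  "'a trigraph \<Rightarrow> 'a set \<Rightarrow> 'a set \<Rightarrow> 'a set \<Rightarrow> 'a list set" where
  "directed_paths_through T A B C =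
     {p. is_path T p \<and> hd p \<in> A \<and> last p \<in> B \<and> interior p \<subseteq> C}"

lemma paths_through_conv_directed:
  "paths_through T A B C = directed_paths_through T A B C \<union> directed_paths_through T B A C"
  by (auto simp: paths_through_def directed_paths_through_def)

lemma rev_mem_directed_paths_through:
  assumes "p \<in> directed_paths_through T A B C"
  shows "rev p \<in> directed_paths_through T B A C"
  using assms
  by (simp add: directed_paths_through_def is_path_rev interior_rev hd_rev last_rev)

lemma paths_through_obtain_directed:
  assumes "p \<in> paths_through T A B C"
  obtains r where "r \<in> directed_paths_through T A B C" "length r = length p"
  using assms rev_mem_directed_paths_through length_rev
  unfolding paths_through_conv_directed by blast

lemma directed_path_nth_mem:
  assumes "p \<in> directed_paths_through T A B C" "i < length p"
  shows "p ! i \<in> (if i = 0 then A else if i = length p - 1 then B else C)"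
proof -
  have "p \<noteq> []"
    using assms(2) by auto
  then have "p ! 0 \<in> A" "p ! (length p - 1) \<in> B"
    using assms(1) by (simp_all add: directed_paths_through_def hd_conv_nth last_conv_nth)
  moreover have "p ! i \<in> C" if "0 < i" "i \<noteq> length p - 1"
  proof -
    have "p ! i \<in> interior p"
      unfolding interior_conv_nth using assms(2) that by (intro CollectI exI[of _ i]) auto
    then show ?thesis
      using assms(1) by (auto simp: directed_paths_through_def)
  qed
  ultimately show ?thesis by simp
qed

lemma directed_path_nth_in_source_iff:
  assumes "p \<in> directed_paths_through T A B C" "i < length p" "A \<inter> (B \<union> C) = {}"
  shows "p ! i \<in> A \<longleftrightarrow> i = 0"
  using directed_path_nth_mem[OF assms(1,2)] assms(3) by (auto split: if_splits)

lemma directed_path_nth_in_target_iff: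
  assumes "p \<in> directed_paths_through T A B C" "i < length p" "B \<inter> (A \<union> C) = {}"
  shows "p ! i \<in> B \<longleftrightarrow> i = length p - 1"
proof -
  have "rev p ! (length p - Suc i) \<in> B \<longleftrightarrow> length p - Suc i = 0"
    using assms by (intro directed_path_nth_in_source_iff[OF rev_mem_directed_paths_through]) auto
  then show ?thesis
    using assms(2) by (auto simp: rev_nth)
qed

lemma set_directed_path_subset:
  assumes "p \<in> directed_paths_through T A B C"
  shows "set p \<subseteq> A \<union> B \<union> C"
proof
  fix x
  assume "x \<in> set p"
  then obtain i where "i < length p" "x = p ! i"
    by (auto simp: in_set_conv_nth)
  then show "x \<in> A \<union> B \<union> C"
    using directed_path_nth_mem[OF assms, of i] by (auto split: if_splits)
qed

lemma directed_path_length_ge_2: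
  assumes "p \<in> directed_paths_through T A B C" "A \<inter> B = {}"
  shows "2 \<le> length p"
proof -
  have "p \<noteq> []" "hd p \<noteq> last p"
    using assms by (auto simp: directed_paths_through_def is_path_def)
  then have "tl p \<noteq> []"
    by (cases p) auto
  then show ?thesis
    by (cases p) (simp_all add: Suc_le_eq)
qed

subsection \<open>Two paths across a 2-join\<close>

lemma two_join_split_sides:
  assumes "two_join_split T X1 X2 A1 B1 C1 A2 B2 C2"
  shows "X1 \<union> X2 = vertices T" "X1 \<inter> X2 = {}" "X1 = A1 \<union> B1 \<union> C1" "X2 = A2 \<union> B2 \<union> C2"
  using assms unfolding two_join_split_def by - (elim conjE, assumption)+

lemma two_join_split_parts_disjoint:
  assumes "two_join_split T X1 X2 A1 B1 C1 A2 B2 C2"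
  shows "A1 \<inter> (B1 \<union> C1) = {}" "B1 \<inter> (A1 \<union> C1) = {}"
    "A2 \<inter> (B2 \<union> C2) = {}" "B2 \<inter> (A2 \<union> C2) = {}"
  using assms by (simp_all add: two_join_split_def Int_Un_distrib Int_commute)

lemma two_join_split_cross_adjacency:
  assumes T: "is_trigraph T" and join: "two_join_split T X1 X2 A1 B1 C1 A2 B2 C2"
    and u: "u \<in> X1" and v: "v \<in> X2"
  shows "prescribed_adjacency T (u \<in> A1 \<and> v \<in> A2 \<or> u \<in> B1 \<and> v \<in> B2) u v"
proof -
  have "u \<in> vertices T" "v \<in> vertices T" "u \<noteq> v"
    using two_join_split_sides(1,2)[OF join] u v by auto
  then have distinct: "distinct_verts T u v"
    by (simp add: distinct_verts_def)
  have "\<not> switchable T u v"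
    using join u v by (simp add: two_join_split_def)
  moreover have "strongly_adjacent T u v \<longleftrightarrow> u \<in> A1 \<and> v \<in> A2 \<or> u \<in> B1 \<and> v \<in> B2"
    using join u v unfolding two_join_split_def by blast
  moreover have "theta T {u, v} \<in> {-1, 0, 1}"
    using T distinct by (simp add: is_trigraph_def distinct_verts_def)
  ultimately show ?thesis
    using distinct
    by (auto simp: prescribed_adjacency_def switchable_def strongly_adjacent_def
        adjacent_def antiadjacent_def)
qed

lemma is_hole_append_opposite_paths:
  assumes T: "is_trigraph T" and join: "two_join_split T X1 X2 A1 B1 C1 A2 B2 C2"
    and p: "p \<in> directed_paths_through T A1 B1 C1" and q: "q \<in> directed_paths_through T B2 A2 C2"
  shows "is_hole T (p @ q)"
proof (rule is_hole_append_paths)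
  note sides = two_join_split_sides[OF join]
    and disjoint = two_join_split_parts_disjoint[OF join]
  show "is_path T p" "is_path T q"
    using p q by (simp_all add: directed_paths_through_def)
  show "2 \<le> length p" "2 \<le> length q"
    using directed_path_length_ge_2[OF p] directed_path_length_ge_2[OF q] disjoint by blast+
  have subset: "set p \<subseteq> X1" "set q \<subseteq> X2"
    using set_directed_path_subset[OF p] set_directed_path_subset[OF q] sides(3,4) by auto
  then show "set p \<inter> set q = {}"
    using sides(2) by blast
  fix i j
  assume ij: "i < length p" "j < length q"
  then have "p ! i \<in> X1" "q ! j \<in> X2"
    using subset by auto
  then have "prescribed_adjacency T (p ! i \<in> A1 \<and> q ! j \<in> A2 \<or> p ! i \<in> B1 \<and> q ! j \<in> B2)
      (p ! i) (q ! j)"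
    by (rule two_join_split_cross_adjacency[OF T join])
  then show "prescribed_adjacency T (i = 0 \<and> j = length q - 1 \<or> i = length p - 1 \<and> j = 0)
      (p ! i) (q ! j)"
    using disjoint
    by (simp add: directed_path_nth_in_source_iff[OF p ij(1)]
        directed_path_nth_in_target_iff[OF p ij(1)] directed_path_nth_in_source_iff[OF q ij(2)]
        directed_path_nth_in_target_iff[OF q ij(2)])
qed

lemma opposite_paths_same_parity:
  assumes "is_trigraph T" "Berge T" "two_join_split T X1 X2 A1 B1 C1 A2 B2 C2"
    and p: "p \<in> paths_through T A1 B1 C1" and q: "q \<in> paths_through T A2 B2 C2"
  shows "even (path_length p) \<longleftrightarrow> even (path_length q)"
proof -
  obtain r where r: "r \<in> directed_paths_through T A1 B1 C1" "length r = length p"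
    using p by (rule paths_through_obtain_directed)
  have "q \<in> paths_through T B2 A2 C2"
    using q by (auto simp: paths_through_conv_directed)
  then obtain s where s: "s \<in> directed_paths_through T B2 A2 C2" "length s = length q"
    by (rule paths_through_obtain_directed)
  have "is_hole T (r @ s)"
    using assms(1,3) r(1) s(1) by (rule is_hole_append_opposite_paths)
  then have "even (length p + length q)"
    using assms(2) r(2) s(2) by (auto simp: Berge_def)
  moreover have "p \<noteq> []" "q \<noteq> []"
    using p q by (auto simp: paths_through_def is_path_def)
  ultimately show ?thesis
    by (simp add: path_length_def)
qed

subsection \<open>Shortest walks\<close>

definition walks_between :: "('a \<Rightarrow> 'a \<Rightarrow> bool) \<Rightarrow> 'a set \<Rightarrow> 'a set \<Rightarrow> 'a list set" where
  "walks_between R A B = {p. p \<noteq> [] \<and> hd p \<in> A \<and> last p \<in> B \<and> successively R p}"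

definition geodesic :: "('a \<Rightarrow> 'a \<Rightarrow> bool) \<Rightarrow> 'a set \<Rightarrow> 'a set \<Rightarrow> 'a list \<Rightarrow> bool" where
  "geodesic R A B p \<longleftrightarrow> is_arg_min length (\<lambda>q. q \<in> walks_between R A B) p"

lemma geodesic_exists:
  assumes "walks_between R A B \<noteq> {}"
  obtains p where "geodesic R A B p"
  using assms is_arg_min_arg_min_nat[of "\<lambda>q. q \<in> walks_between R A B" _ length]
  unfolding geodesic_def by blast

lemma geodesic_mem_walks_between: "geodesic R A B p \<Longrightarrow> p \<in> walks_between R A B"
  by (simp add: geodesic_def is_arg_min_def)

lemma geodesic_length_le:
  "\<lbrakk>geodesic R A B p; q \<in> walks_between R A B\<rbrakk> \<Longrightarrow> length p \<le> length q"
  by (simp add: geodesic_def is_arg_min_linorder)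

lemma successively_take: "successively R p \<Longrightarrow> successively R (take n p)"
  and successively_drop: "successively R p \<Longrightarrow> successively R (drop n p)"
  by (metis append_take_drop_id successively_append_iff)+

lemma last_take_Suc: "i < length p \<Longrightarrow> last (take (Suc i) p) = p ! i"
  by (simp add: take_Suc_conv_app_nth)

lemma geodesic_nth_notin_source:
  assumes p: "geodesic R A B p" and i: "0 < i" "i < length p"
  shows "p ! i \<notin> A"
proof
  assume "p ! i \<in> A"
  then have "drop i p \<in> walks_between R A B"
    using geodesic_mem_walks_between[OF p] i
    by (simp add: walks_between_def hd_drop_conv_nth successively_drop)
  then show False
    using geodesic_length_le[OF p] i by fastforce
qed

lemma geodesic_nth_notin_target:
  assumes p: "geodesic R A B p" and i: "Suc i < length p"
  shows "p ! i \<notin> B"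
proof
  assume "p ! i \<in> B"
  then have "take (Suc i) p \<in> walks_between R A B"
    using geodesic_mem_walks_between[OF p] i
    by (simp add: walks_between_def last_take_Suc successively_take)
  then show False
    using geodesic_length_le[OF p] i by fastforce
qed

lemma geodesic_no_chord:
  assumes p: "geodesic R A B p" and ij: "Suc i < j" "j < length p"
  shows "\<not> R (p ! i) (p ! j)"
proof
  assume "R (p ! i) (p ! j)"
  then have "take (Suc i) p @ drop j p \<in> walks_between R A B"
    using geodesic_mem_walks_between[OF p] ij
    by (auto simp: walks_between_def successively_append_iff last_take_Suc hd_drop_conv_nth
        successively_take successively_drop)
  then show False
    using geodesic_length_le[OF p] ij by fastforce
qed

lemma geodesic_distinct:
  assumes p: "geodesic R A B p"
  shows "distinct p"
proof -
  have walk: "p \<noteq> []" "hd p \<in> A" "successively R p"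
    using geodesic_mem_walks_between[OF p] by (simp_all add: walks_between_def)
  have "p ! i \<noteq> p ! j" if ij: "i < j" "j < length p" for i j
  proof (cases i)
    case 0
    then have "p ! i \<in> A"
      using walk(1,2) by (simp add: hd_conv_nth)
    then show ?thesis
      using geodesic_nth_notin_source[OF p, of j] ij by auto
  next
    case (Suc k)
    then have "R (p ! k) (p ! i)"
      using walk(3) ij by (simp add: successively_nth)
    then show ?thesis
      using geodesic_no_chord[OF p, of k j] ij Suc by auto
  qed
  then show ?thesis
    by (metis distinct_conv_nth nat_neq_iff)
qed

lemma geodesic_interior_disjoint:
  assumes "geodesic R A B p"
  shows "interior p \<inter> (A \<union> B) = {}"
  using geodesic_nth_notin_source[OF assms] geodesic_nth_notin_target[OF assms]
  by (fastforce simp: interior_conv_nth)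

lemma geodesic_is_path:
  assumes T: "is_trigraph T" and A: "A \<subseteq> vertices T" and p: "geodesic (adjacent T) A B p"
  shows "is_path T p"
proof -
  have walk: "p \<noteq> []" "hd p \<in> A" "successively (adjacent T) p"
    using geodesic_mem_walks_between[OF p] by (simp_all add: walks_between_def)
  have consecutive: "adjacent T (p ! i) (p ! Suc i)" if "Suc i < length p" for i
    using walk(3) that by (rule successively_nth)
  have vertex: "p ! i \<in> vertices T" if "i < length p" for i
  proof (cases i)
    case 0
    then show ?thesis
      using walk(1,2) A by (auto simp: hd_conv_nth)
  next
    case (Suc k)
    then show ?thesis
      using consecutive[of k] that by (simp add: adjacent_def distinct_verts_def)
  qed
  have "prescribed_adjacency T (j - i = 1) (p ! i) (p ! j)" if ij: "i < j" "j < length p" for i j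
  proof (cases "j = Suc i")
    case True
    then show ?thesis
      using consecutive ij by (simp add: prescribed_adjacency_def)
  next
    case False
    then have "\<not> adjacent T (p ! i) (p ! j)"
      using geodesic_no_chord[OF p] ij by simp
    moreover have "p ! i \<noteq> p ! j"
      using geodesic_distinct[OF p] ij by (simp add: nth_eq_iff_index_eq)
    ultimately show ?thesis
      using not_adjacent_imp_antiadjacent[OF T] vertex ij False
      by (auto simp: prescribed_adjacency_def)
  qed
  then have "adjacency_pattern T (\<lambda>i j. j - i = 1) p"
    by (simp add: adjacency_pattern_def)
  moreover have "set p \<subseteq> vertices T"
    using vertex by (auto simp: in_set_conv_nth)
  ultimately show ?thesis
    using walk(1) geodesic_distinct[OF p] by (simp add: is_path_iff_adjacency_pattern)
qed

subsection \<open>Induced subtrigraphs and components\<close>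

lemma vertices_induced [simp]: "vertices (induced T X) = vertices T \<inter> X"
  by (simp add: induced_def)

lemma is_trigraph_induced: "is_trigraph T \<Longrightarrow> is_trigraph (induced T X)"
  by (auto simp: is_trigraph_def induced_def)

lemma adjacent_induced_iff:
  "adjacent (induced T X) u v \<longleftrightarrow> adjacent T u v \<and> u \<in> X \<and> v \<in> X"
  by (auto simp: adjacent_def distinct_verts_def induced_def)

lemma antiadjacent_induced_iff:
  "antiadjacent (induced T X) u v \<longleftrightarrow> antiadjacent T u v \<and> u \<in> X \<and> v \<in> X"
  by (auto simp: antiadjacent_def distinct_verts_def induced_def)

lemma is_path_of_induced: "is_path (induced T X) p \<Longrightarrow> is_path T p"
  by (auto simp: is_path_def adjacent_induced_iff antiadjacent_induced_iff split: if_splits)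

lemma connected_set_singleton:
  assumes "a \<in> vertices T"
  shows "connected_set T {a}"
  using assms
  by (auto simp: connected_set_def connected_conv full_realization_def)

lemma component_containing:
  assumes "finite (vertices T)" "a \<in> vertices T"
  obtains Y where "Y \<in> components T" "a \<in> Y"
proof -
  have "finite {Y. connected_set T Y}"
    using assms(1) by (rule finite_subset[rotated, OF finite_Pow_iff[THEN iffD2]])
      (auto simp: connected_set_def)
  moreover have "connected_set T {a}"
    using assms(2) by (rule connected_set_singleton)
  ultimately obtain Y where "connected_set T Y" "a \<in> Y"
    and "\<forall>Z. connected_set T Z \<longrightarrow> Y \<subseteq> Z \<longrightarrow> Y = Z"
    using finite_has_maximal2[of "{Y. connected_set T Y}" "{a}"] by auto
  then show thesis
    using that[of Y] by (auto simp: components_def)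
qed

lemma vwalk_full_realization_imp_successively:
  "vwalk p (with_proj (full_realization T)) \<Longrightarrow> successively (adjacent T) p"
  by (induction rule: vwalk_induct) (simp_all add: full_realization_def)

lemma connected_set_walks_between_nonempty:
  assumes T: "is_trigraph T" and Y: "connected_set T Y" and ab: "a \<in> Y" "b \<in> Y"
  shows "walks_between (adjacent T) {a} {b} \<noteq> {}"
proof -
  interpret pair_graph "full_realization (induced T Y)"
    using T by (intro pair_graph_full_realization is_trigraph_induced)
  have "strongly_connected (with_proj (full_realization (induced T Y)))"
    using Y pair_sym_arcs
    by (intro symmetric_connected_imp_strongly_connected) (simp_all add: connected_set_def)
  moreover have "Y \<subseteq> vertices T"
    using Y by (simp add: connected_set_def)
  ultimately have "a \<rightarrow>\<^sup>*\<^bsub>with_proj (full_realization (induced T Y))\<^esub> b"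
    using ab by (auto simp: strongly_connected_def full_realization_def)
  then obtain p where p: "vwalk p (with_proj (full_realization (induced T Y)))"
      "hd p = a" "last p = b"
    by (auto simp: reachable_vwalk_conv)
  have "successively (adjacent T) p"
    using vwalk_full_realization_imp_successively[OF p(1)]
    by (rule successively_mono) (simp add: adjacent_induced_iff)
  then have "p \<in> walks_between (adjacent T) {a} {b}"
    using p by (simp add: walks_between_def vwalk_def)
  then show ?thesis by blast
qed

lemma paths_through_nonempty:
  assumes T: "is_trigraph T" and subset: "A \<union> B \<union> C \<subseteq> vertices T" and A: "A \<noteq> {}"
    and meets_target: "\<And>Y. Y \<in> components (induced T (A \<union> B \<union> C)) \<Longrightarrow> Y \<inter> B \<noteq> {}"
  shows "paths_through T A B C \<noteq> {}"
proof -
  let ?I = "induced T (A \<union> B \<union> C)"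
  have I: "is_trigraph ?I" "vertices ?I = A \<union> B \<union> C"
    using is_trigraph_induced[OF T] subset by auto
  obtain a where a: "a \<in> A"
    using A by blast
  then obtain Y where Y: "Y \<in> components ?I" "a \<in> Y"
    using component_containing[of ?I a] I by (auto simp: is_trigraph_def)
  obtain b where b: "b \<in> Y" "b \<in> B"
    using meets_target[OF Y(1)] by blast
  have "walks_between (adjacent ?I) {a} {b} \<noteq> {}"
    using I(1) Y b(1) by (intro connected_set_walks_between_nonempty) (auto simp: components_def)
  then have "walks_between (adjacent ?I) A B \<noteq> {}"
    using a b(2) by (auto simp: walks_between_def)
  then obtain p where p: "geodesic (adjacent ?I) A B p"
    by (rule geodesic_exists)
  have path: "is_path ?I p"
    using geodesic_is_path[OF I(1) _ p] I(2) by blast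
  have "interior p \<subseteq> set p"
    by (auto simp: interior_conv_nth)
  also have "\<dots> \<subseteq> A \<union> B \<union> C"
    using path I(2) by (simp add: is_path_def)
  finally have "interior p \<subseteq> C"
    using geodesic_interior_disjoint[OF p] by blast
  then have "p \<in> paths_through T A B C"
    using is_path_of_induced[OF path] geodesic_mem_walks_between[OF p]
    by (simp add: paths_through_def walks_between_def)
  then show ?thesis by blast
qed

theorem theorem2p4:
  fixes T :: "'a trigraph" and X1 X2 A1 B1 C1 A2 B2 C2 :: "'a set"
  assumes "is_trigraph T"
    and "Berge T"
    and "proper_two_join_split T X1 X2 A1 B1 C1 A2 B2 C2"
  shows "\<forall>p \<in> paths_through T A1 B1 C1 \<union> paths_through T A2 B2 C2.
         \<forall>q \<in> paths_through T A1 B1 C1 \<union> paths_through T A2 B2 C2.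
           even (path_length p) \<longleftrightarrow> even (path_length q)"
proof -
  have join: "two_join_split T X1 X2 A1 B1 C1 A2 B2 C2"
    using assms(3) by (simp add: proper_two_join_split_def)
  note sides = two_join_split_sides[OF join]
  have "A1 \<noteq> {}" "A2 \<noteq> {}"
    using join by (simp_all add: two_join_split_def)
  then have "paths_through T A1 B1 C1 \<noteq> {}" "paths_through T A2 B2 C2 \<noteq> {}"
    using assms(1,3) sides unfolding proper_two_join_split_def
    by (metis paths_through_nonempty Un_upper1, metis paths_through_nonempty Un_upper2)
  then show ?thesis
    using opposite_paths_same_parity[OF assms(1,2) join] by blast
qed

end
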